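(* Let $n\ge 1$, let $m$ be a complex number (or an indeterminate), and let $(U_e)_{e\ge0}$ be defined by $U_0=0$, $U_1=1$, $U_{e+1}=mU_e+U_{e-1}$. Let $T_n(m)=(a_{i,j})_{1\le i,j\le n}$ with $a_{i,j}=m^{i+j-n-1}\binom{i-1}{n-j}$, and let $w=((-1)^nU_{n-1},(-1)^{n-1}U_{n-2},\ldots,-U_0)^t$, i.e. $w_j=(-1)^{n+1-j}U_{n-j}$. Then: (1) for every integer $e\ge0$, $T_n(m)^{e+1}w=(U_{(n-1)e},U_{(n-1)e+1},\ldots,U_{(n-1)(e+1)})^t$; (2) writing $T_n(m)^e=(a^{(e)}_{i,j})$, for every $e\ge1$ and all $2\le i,j\le n$, \[U_{e-1}a^{(e)}_{i,j}+U_e a^{(e)}_{i,j-1}=U_e a^{(e)}_{i-1,j}+U_{e+1}a^{(e)}_{i-1,j-1};\] (3) $T_n(m)$ is the unique $n\times n$ matrix $(b_{i,j})$ such that $b_{1,j}=0$ for $1\le j<n$, $b_{i,n}=m^{i-1}$ for $1\le i\le n$, and $b_{i,j}=m\,b_{i-1,j}+b_{i-1,j+1}$ for $2\le i\le n$, $1\le j\le n-1$.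
   Context: Binomial coefficients $\binom{a}{b}$ are $0$ when $b<0$ or $b>a$; the entry $m^{i+j-n-1}\binom{i-1}{n-j}$ is $0$ whenever the binomial coefficient vanishes, and otherwise the exponent is nonnegative, so the entries are polynomials in $m$. *)

theory Defs
  imports "Jordan_Normal_Form.Matrix"
begin

fun U :: "'a::comm_ring_1 \<Rightarrow> nat \<Rightarrow> 'a" where
  "U m 0 = 0"
| "U m (Suc 0) = 1"
| "U m (Suc (Suc e)) = m * U m (Suc e) + U m e"

(* Library matrices are indexed from 0; "ent A i j" is the entry in row i and column j
   counted from 1, and is meaningful only for positive i and j. *)
abbreviation ent :: "'a mat \<Rightarrow> nat \<Rightarrow> nat \<Rightarrow> 'a" where
  "ent A i j \<equiv> A $$ (i - 1, j - 1)"

(* The indices i, j are counted from 1. The exponent is a truncated difference of natural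
   numbers; truncation happens only for i + j < n + 1, and then i - 1 < n - j, so that
   the binomial coefficient is 0. *)
definition T_entry :: "nat \<Rightarrow> 'a::comm_ring_1 \<Rightarrow> nat \<Rightarrow> nat \<Rightarrow> 'a" where
  "T_entry n m i j = m ^ (i + j - n - 1) * of_nat ((i - 1) choose (n - j))"

definition T :: "nat \<Rightarrow> 'a::comm_ring_1 \<Rightarrow> 'a mat" where
  "T n m = mat n n (\<lambda>(i, j). T_entry n m (i + 1) (j + 1))"

(* With j counted from 1, the j-th coordinate is (-1)^(n+1-j) U_(n-j); below, j is
   the index counted from 0. *)
definition w :: "nat \<Rightarrow> 'a::comm_ring_1 \<Rightarrow> 'a vec" where
  "w n m = vec n (\<lambda>j. (-1) ^ (n - j) * U m (n - (j + 1)))"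

end

(*
  In generating-function terms T_n(m) is the (n-1)-st symmetric power of the substitution
  (y, x) -> (x, m x + y): it sends the vector with entries x^j y^(n-1-j) to the one with entries
  (m x + y)^i x^(n-1-i), by the binomial theorem.  Iterating and putting y = 1, the i-th row of the
  e-th power (counted from 0) has generating polynomial
  (U_e + U_(e+1) x)^i (U_(e-1) + U_e x)^(n-1-i); since consecutive rows differ by exchanging one
  linear factor, comparing coefficients yields (2).  For (1), T_n(m) shifts any window of length n
  of a solution of V_(k+2) = m V_(k+1) + V_k by n - 1 places, and w is the window of the extension
  of U to negative indices that ends at U_0.  Finally, (3) is Pascal's rule.
*)
theory Submission
  imports Defs "HOL-Computational_Algebra.Polynomial"
begin

section \<open>Row sums and windows of recurrent sequences\<close>

lemma T_carrier [simp]: "T n m \<in> carrier_mat n n"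
  by (simp add: T_def)

lemma dim_T [simp]: "dim_row (T n m) = n" "dim_col (T n m) = n"
  by (simp_all add: T_def)

lemma T_index:
  assumes "i < n" "j < n"
  shows "T n m $$ (i, j) = m ^ (i - (n - 1 - j)) * of_nat (i choose (n - 1 - j))"
proof -
  have "i + j + 1 - n = i - (n - 1 - j)" using assms by linarith
  then show ?thesis using assms by (simp add: T_def T_entry_def)
qed

text \<open>Entries in columns before \<open>n - 1 - i\<close> vanish; putting
  \<open>s = j - (n - 1 - i)\<close> and using the symmetry of binomial coefficients turns row
  \<open>i\<close> into the coefficients of (1 + m x)^i.\<close>

lemma T_row_sum:
  assumes "i < n"
  shows "(\<Sum>j = 0..<n. T n m $$ (i, j) * v j)
       = (\<Sum>s\<le>i. of_nat (i choose s) * m ^ s * v (n - 1 - i + s))"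
proof -
  have "(\<Sum>j = 0..<n. T n m $$ (i, j) * v j) = (\<Sum>j\<in>{n - 1 - i..n - 1}. T n m $$ (i, j) * v j)"
    using assms by (intro sum.mono_neutral_right) (auto simp: T_index binomial_eq_0)
  also have "\<dots> = (\<Sum>s\<le>i. of_nat (i choose s) * m ^ s * v (n - 1 - i + s))"
  proof (rule sum.reindex_bij_witness[where i = "\<lambda>s. n - 1 - i + s" and j = "\<lambda>j. j - (n - 1 - i)"])
    fix j assume j: "j \<in> {n - 1 - i..n - 1}"
    then have eq: "n - 1 - j = i - (j - (n - 1 - i))" "j - (n - 1 - i) \<le> i" using assms by auto
    from eq have "i choose (n - 1 - j) = i choose (j - (n - 1 - i))"
      by (metis binomial_symmetric)
    moreover have "n - 1 - i + (j - (n - 1 - i)) = j" using j by simp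
    moreover have "j < n" using j assms by auto
    moreover have "i - (n - 1 - j) = j - (n - 1 - i)" using eq by linarith
    ultimately show "of_nat (i choose (j - (n - 1 - i))) * m ^ (j - (n - 1 - i))
        * v (n - 1 - i + (j - (n - 1 - i))) = T n m $$ (i, j) * v j"
      using T_index[OF assms, of j m] by (simp only: mult.commute)
  qed (use assms in auto)
  finally show ?thesis .
qed

text \<open>With E the shift operator, the hypothesis reads E^2 = 1 + m E on \<open>V\<close>, so (1
  + m E)^i = E^(2 i). The induction splits off one factor by Pascal's rule.\<close>

lemma binomial_recurrence_sum:
  fixes m :: "'a::comm_ring_1"
  assumes V: "\<And>k. V (k + 2) = m * V (k + 1) + V k"
  shows "(\<Sum>s\<le>i. of_nat (i choose s) * m ^ s * V (q + s)) = V (q + 2 * i)"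
proof (induction i arbitrary: q)
  case 0
  show ?case by simp
next
  case (Suc i)
  let ?a = "\<lambda>q s. of_nat (i choose s) * m ^ s * V (q + s)"
  have "(\<Sum>s\<le>Suc i. of_nat (Suc i choose s) * m ^ s * V (q + s))
      = V q + (\<Sum>s\<le>i. m * ?a (Suc q) s + ?a q (Suc s))"
    by (simp add: sum.atMost_Suc_shift algebra_simps del: sum.atMost_Suc)
  also have "\<dots> = m * (\<Sum>s\<le>i. ?a (Suc q) s) + (\<Sum>s\<le>Suc i. ?a q s)"
    using sum.atMost_Suc_shift[of "?a q" i]
    by (simp add: sum.distrib sum_distrib_left mult_ac binomial_eq_0)
  also have "\<dots> = m * V (Suc q + 2 * i) + V (q + 2 * i)"
    using Suc.IH[of "Suc q"] Suc.IH[of q] by (simp add: binomial_eq_0)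
  also have "\<dots> = V (q + 2 * Suc i)"
    using V[of "q + 2 * i"] by simp
  finally show ?case .
qed

lemma T_mult_vec_recurrence:
  fixes m :: "'a::comm_ring_1"
  assumes "\<And>k. V (k + 2) = m * V (k + 1) + V k"
  shows "T n m *\<^sub>v vec n V = vec n (\<lambda>i. V (n - 1 + i))"
proof (rule eq_vecI)
  fix i assume "i < dim_vec (vec n (\<lambda>i. V (n - 1 + i)))"
  then have i: "i < n" by simp
  have "(T n m *\<^sub>v vec n V) $ i = (\<Sum>j = 0..<n. T n m $$ (i, j) * V j)"
    using i by (simp add: scalar_prod_def)
  also have "\<dots> = V (n - 1 - i + 2 * i)"
    using i by (simp only: T_row_sum binomial_recurrence_sum[OF assms])
  also have "n - 1 - i + 2 * i = n - 1 + i" using i by linarith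
  finally show "(T n m *\<^sub>v vec n V) $ i = vec n (\<lambda>i. V (n - 1 + i)) $ i"
    using i by simp
qed simp

section \<open>Powers applied to the vector \<open>w\<close>\<close>

text \<open>The sequence $U$ continued to negative indices and shifted by \<open>N\<close>, so that \<open>U_shift m N k\<close>
  is $U_{k-N}$, where $U_{-r} = (-1)^{r+1} U_r$.\<close>

definition U_shift :: "'a::comm_ring_1 \<Rightarrow> nat \<Rightarrow> nat \<Rightarrow> 'a" where
  "U_shift m N k = (if k < N then (-1) ^ (N - k + 1) * U m (N - k) else U m (k - N))"

lemma U_shift_recurrence: "U_shift m N (k + 2) = m * U_shift m N (k + 1) + U_shift m N k"
proof -
  consider "N \<le> k" | "N = k + 1" | d where "N = k + 2 + d"
    by (metis Suc_eq_plus1 add_2_eq_Suc' le_Suc_eq le_add_diff_inverse not_less_eq_eq)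
  then show ?thesis
  proof cases
    case 1
    then obtain d where "k = N + d" using le_Suc_ex by blast
    then show ?thesis by (simp add: U_shift_def)
  next
    case 2
    then show ?thesis by (simp add: U_shift_def)
  next
    case 3
    \<comment> \<open>For \<open>d = 0\<close> the index \<open>k + 2\<close> equals
      \<open>N\<close> and lies in the unsigned branch; for larger \<open>d\<close> all three
      indices are in the signed one.\<close>
    then show ?thesis by (cases d) (simp_all add: U_shift_def algebra_simps numeral_eq_Suc)
  qed
qed

lemma w_eq_U_shift: "w n m = vec n (U_shift m (n - 1))"
proof (rule eq_vecI)
  fix j assume "j < dim_vec (vec n (U_shift m (n - 1)))"
  then have j: "j < n" by simp
  then have "n - j = Suc (n - 1 - j)" "n - (j + 1) = n - 1 - j" by auto
  \<comment> \<open>At \<open>j = n - 1\<close> only \<open>w\<close> carries a sign, which is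
    harmless because U_0 = 0.\<close>
  then show "w n m $ j = vec n (U_shift m (n - 1)) $ j"
    using j by (auto simp: w_def U_shift_def)
qed (simp add: w_def)

text \<open>\<open>pow_mat\<close> recurses by multiplication on the right, whereas the inductions
  below apply \<open>T n m\<close> on the left.\<close>

lemma pow_mat_Suc_left:
  assumes "A \<in> carrier_mat n n"
  shows "A ^\<^sub>m (Suc e) = A * A ^\<^sub>m e"
proof (induction e)
  case 0
  show ?case using assms by simp
next
  case (Suc e)
  have "A ^\<^sub>m Suc (Suc e) = (A * A ^\<^sub>m e) * A" using Suc by simp
  also have "\<dots> = A * A ^\<^sub>m Suc e" using assms by (simp add: assoc_mult_mat[of _ n n _ n _ n])
  finally show ?case .
qed

lemma T_pow_mult_w:
  "(T n m ^\<^sub>m (e + 1)) *\<^sub>v w n m = vec n (\<lambda>k. U m ((n - 1) * e + k))"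
proof (induction e)
  case 0
  have "T n m *\<^sub>v w n m = vec n (\<lambda>i. U_shift m (n - 1) (n - 1 + i))"
    unfolding w_eq_U_shift by (intro T_mult_vec_recurrence U_shift_recurrence)
  then show ?case by (simp add: U_shift_def left_mult_one_mat[OF T_carrier])
next
  case (Suc e)
  have "w n m \<in> carrier_vec n" by (simp add: w_def)
  then have "(T n m ^\<^sub>m (Suc e + 1)) *\<^sub>v w n m = T n m *\<^sub>v ((T n m ^\<^sub>m (e + 1)) *\<^sub>v w n m)"
    using pow_mat_Suc_left[OF T_carrier, of n m "Suc e"]
      assoc_mult_mat_vec[OF T_carrier pow_carrier_mat[OF T_carrier], of "w n m" n m m "Suc e"]
    by (simp del: pow_mat.simps(2))
  also have "\<dots> = vec n (\<lambda>i. U m ((n - 1) * e + (n - 1 + i)))"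
    unfolding Suc by (rule T_mult_vec_recurrence) simp
  finally show ?case by (simp only: mult_Suc_right add.assoc add.left_commute)
qed

section \<open>Generating polynomials of the rows of powers\<close>

text \<open>The linear form $U_{e-1} + U_e x$; the first equation encodes $U_{-1} = 1$.\<close>

fun lin :: "'a::comm_ring_1 \<Rightarrow> nat \<Rightarrow> 'a poly" where
  "lin m 0 = 1"
| "lin m (Suc e) = [:U m e, U m (Suc e):]"

lemma lin_Suc_Suc: "lin m (Suc (Suc e)) = smult m (lin m (Suc e)) + lin m e"
  by (cases e) (simp_all add: one_pCons)

lemma T_pow_index:
  assumes "i < n" "j < n"
  shows "(T n m ^\<^sub>m e) $$ (i, j) = coeff (lin m (Suc e) ^ i * lin m e ^ (n - 1 - i)) j"
  using assms
proof (induction e arbitrary: i)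
  case 0
  \<comment> \<open>Here \<open>lin m 1\<close> is x and \<open>lin m 0\<close> is 1, so row
    \<open>i\<close> of the identity has generating polynomial x^i.\<close>
  have "[:0, 1:] ^ i = monom (1 :: 'a) i" by (simp add: monom_altdef)
  then show ?case using 0 by simp
next
  case (Suc e)
  let ?P = "lin m (Suc e)" and ?Q = "lin m e" and ?F = "\<lambda>k. lin m (Suc e) ^ k * lin m e ^ (n - 1 - k)"
  have "(T n m ^\<^sub>m Suc e) $$ (i, j) = (\<Sum>k = 0..<n. T n m $$ (i, k) * (T n m ^\<^sub>m e) $$ (k, j))"
    using Suc.prems pow_mat_Suc_left[OF T_carrier, of n m e]
    by (simp add: scalar_prod_def del: pow_mat.simps(2))
  also have "\<dots> = (\<Sum>k = 0..<n. T n m $$ (i, k) * coeff (?F k) j)"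
    using Suc by (intro sum.cong) auto
  also have "\<dots> = (\<Sum>s\<le>i. of_nat (i choose s) * m ^ s * coeff (?F (n - 1 - i + s)) j)"
    using Suc.prems by (simp only: T_row_sum)
  also have "\<dots> = coeff (\<Sum>s\<le>i. smult (of_nat (i choose s) * m ^ s) (?F (n - 1 - i + s))) j"
    by (simp add: coeff_sum)
  \<comment> \<open>Every term contains \<open>?P ^ (n - 1 - i)\<close>; what remains is the
    binomial expansion of (m P + Q)^i, and m P + Q is the next linear form.\<close>
  also have "(\<Sum>s\<le>i. smult (of_nat (i choose s) * m ^ s) (?F (n - 1 - i + s)))
      = (\<Sum>s\<le>i. of_nat (i choose s) * smult m ?P ^ s * ?Q ^ (i - s)) * ?P ^ (n - 1 - i)"
    unfolding sum_distrib_right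
  proof (rule sum.cong)
    fix s assume "s \<in> {..i}"
    then have "n - 1 - (n - 1 - i + s) = i - s" using Suc.prems by auto
    then show "smult (of_nat (i choose s) * m ^ s) (?F (n - 1 - i + s))
        = of_nat (i choose s) * smult m ?P ^ s * ?Q ^ (i - s) * ?P ^ (n - 1 - i)"
      by (simp add: smult_power of_nat_poly power_add mult_ac del: lin.simps)
  qed simp
  also have "\<dots> = lin m (Suc (Suc e)) ^ i * ?P ^ (n - 1 - i)"
    by (simp only: lin_Suc_Suc binomial_ring)
  finally show ?case .
qed

lemma T_pow_relation:
  assumes "e \<ge> 1" "i \<in> {2..n}" "j \<in> {2..n}"
  shows "U m (e - 1) * ent (T n m ^\<^sub>m e) i j + U m e * ent (T n m ^\<^sub>m e) i (j - 1)
       = U m e * ent (T n m ^\<^sub>m e) (i - 1) j + U m (e + 1) * ent (T n m ^\<^sub>m e) (i - 1) (j - 1)"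
proof -
  obtain d a b where d: "e = Suc d" and a: "i = Suc (Suc a)" and b: "j = Suc (Suc b)"
    using assms by (metis atLeastAtMost_iff One_nat_def Suc_le_D numeral_2_eq_2 Suc_le_mono)
  let ?P = "lin m (Suc e)" and ?Q = "lin m e"
  let ?F = "\<lambda>k. ?P ^ k * ?Q ^ (n - 1 - k)"
  \<comment> \<open>Both products below equal P^(a+1) Q^(n-1-a). Since \<open>e\<close> is positive,
    Q has coefficients U_(e-1) and U_e, so the coefficient of x^(b+1) yields the four terms.\<close>
  have "n - 1 - a = Suc (n - 1 - Suc a)" using assms a by auto
  then have "?Q * ?F (Suc a) = ?P * ?F a" by (simp add: mult_ac del: lin.simps)
  then have "coeff (?Q * ?F (Suc a)) (Suc b) = coeff (?P * ?F a) (Suc b)" by simp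
  then have *: "U m d * coeff (?F (Suc a)) (Suc b) + U m e * coeff (?F (Suc a)) b
      = U m e * coeff (?F a) (Suc b) + U m (Suc e) * coeff (?F a) b"
    by (simp add: d mult_pCons_left del: U.simps)
  have "ent (T n m ^\<^sub>m e) (Suc k) (Suc l) = coeff (?F k) l" if "k < n" "l < n" for k l
    using T_pow_index[OF that] by simp
  then show ?thesis using * assms a b d by (simp del: lin.simps pow_mat.simps U.simps)
qed

section \<open>Pascal's rule and uniqueness\<close>

lemma T_Suc_index:
  assumes "Suc i < n" "Suc j < n"
  shows "T n m $$ (Suc i, j) = m * T n m $$ (i, j) + T n m $$ (i, Suc j)"
proof -
  obtain r where r: "n - 1 - j = Suc r" "n - 1 - Suc j = r"
    using assms by (metis Suc_diff_Suc Suc_lessE diff_Suc_1)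
  show ?thesis
  proof (cases "r < i")
    case True
    then have "m ^ (i - r) = m * m ^ (i - Suc r)"
      by (metis Suc_diff_Suc power_Suc)
    then show ?thesis using assms r by (simp add: T_index algebra_simps)
  next
    \<comment> \<open>The exponent \<open>i - Suc r\<close> is truncated here, but its factor
      \<open>i choose Suc r\<close> is 0.\<close>
    case False
    then show ?thesis using assms r by (simp add: T_index binomial_eq_0)
  qed
qed

text \<open>Counting from 0 removes the truncated subtractions, so that induction on the row index
  applies directly.\<close>

lemma ent_conditions_iff:
  "((\<forall>j. 1 \<le> j \<and> j < n \<longrightarrow> ent B 1 j = 0) \<and>
    (\<forall>i\<in>{1..n}. ent B i n = m ^ (i - 1)) \<and>
    (\<forall>i\<in>{2..n}. \<forall>j\<in>{1..n - 1}. ent B i j = m * ent B (i - 1) j + ent B (i - 1) (j + 1)))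
   \<longleftrightarrow>
   ((\<forall>j. Suc j < n \<longrightarrow> B $$ (0, j) = 0) \<and>
    (\<forall>i<n. B $$ (i, n - 1) = m ^ i) \<and>
    (\<forall>i j. Suc i < n \<longrightarrow> Suc j < n \<longrightarrow> B $$ (Suc i, j) = m * B $$ (i, j) + B $$ (i, Suc j)))"
proof -
  have "(\<forall>j. 1 \<le> j \<and> j < n \<longrightarrow> ent B 1 j = 0) \<longleftrightarrow> (\<forall>j. Suc j < n \<longrightarrow> B $$ (0, j) = 0)"
    by (metis One_nat_def Suc_le_D diff_Suc_1 le_add1 plus_1_eq_Suc diff_self_eq_0)
  moreover have "(\<forall>i\<in>{1..n}. ent B i n = m ^ (i - 1)) \<longleftrightarrow> (\<forall>i<n. B $$ (i, n - 1) = m ^ i)"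
    unfolding Ball_def atLeastAtMost_iff
    by (metis One_nat_def Suc_le_D Suc_le_eq diff_Suc_1 le_add1 plus_1_eq_Suc)
  moreover have "(\<forall>i\<in>{2..n}. \<forall>j\<in>{1..n - 1}. ent B i j = m * ent B (i - 1) j + ent B (i - 1) (j + 1))
    \<longleftrightarrow> (\<forall>i j. Suc i < n \<longrightarrow> Suc j < n \<longrightarrow> B $$ (Suc i, j) = m * B $$ (i, j) + B $$ (i, Suc j))"
    (is "?L \<longleftrightarrow> ?R")
  proof
    assume L: ?L
    show ?R
    proof (intro allI impI)
      fix i j assume "Suc i < n" "Suc j < n"
      then show "B $$ (Suc i, j) = m * B $$ (i, j) + B $$ (i, Suc j)"
        using L[rule_format, of "Suc (Suc i)" "Suc j"] by simp
    qed
  next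
    assume R: ?R
    show ?L
    proof (intro ballI)
      fix i j assume ij: "i \<in> {2..n}" "j \<in> {1..n - 1}"
      then have "Suc (i - 2) = i - 1" "Suc (j - 1) = j" "i - 1 < n" "j < n" by auto
      then show "ent B i j = m * ent B (i - 1) j + ent B (i - 1) (j + 1)"
        using R[rule_format, of "i - 2" "j - 1"] by (simp add: numeral_2_eq_2)
    qed
  qed
  ultimately show ?thesis by simp
qed

text \<open>The recurrence computes each row from the previous one except for its last entry, which
  is prescribed; hence induction on rows determines the matrix.\<close>

lemma T_characterization:
  assumes "n \<ge> 1" "B \<in> carrier_mat n n"
  shows "((\<forall>j. Suc j < n \<longrightarrow> B $$ (0, j) = 0) \<and>
    (\<forall>i<n. B $$ (i, n - 1) = m ^ i) \<and>
    (\<forall>i j. Suc i < n \<longrightarrow> Suc j < n \<longrightarrow> B $$ (Suc i, j) = m * B $$ (i, j) + B $$ (i, Suc j)))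
    \<longleftrightarrow> B = T n m" (is "?C \<longleftrightarrow> _")
proof
  have T0: "T n m $$ (0, j) = 0" if "Suc j < n" for j
    using that by (simp add: T_index binomial_eq_0)
  have Tn: "T n m $$ (i, n - 1) = m ^ i" if "i < n" for i
    using that by (simp add: T_index)
  {
    assume "B = T n m"
    then show ?C using T0 Tn T_Suc_index by metis
  }
  assume C: ?C
  have "B $$ (i, j) = T n m $$ (i, j)" if "i < n" "j < n" for i j
    using that
  proof (induction i arbitrary: j)
    case 0
    then consider "Suc j < n" | "j = n - 1" by linarith
    then show ?case using C T0 Tn 0 by cases auto
  next
    case (Suc i)
    then consider "Suc j < n" | "j = n - 1" by linarith
    then show ?case using C Tn Suc by cases (simp_all add: T_Suc_index)
  qed
  then show "B = T n m" using assms by (intro eq_matI) auto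
qed

theorem theorem3p2:
  fixes n :: nat and m :: "'a::comm_ring_1"
  assumes "n \<ge> 1"
  shows
    "(\<forall>e::nat. (T n m ^\<^sub>m (e + 1)) *\<^sub>v w n m = vec n (\<lambda>k. U m ((n - 1) * e + k))) \<and>
     (\<forall>e\<ge>1. \<forall>i\<in>{2..n}. \<forall>j\<in>{2..n}.
        U m (e - 1) * ent (T n m ^\<^sub>m e) i j + U m e * ent (T n m ^\<^sub>m e) i (j - 1)
        = U m e * ent (T n m ^\<^sub>m e) (i - 1) j
          + U m (e + 1) * ent (T n m ^\<^sub>m e) (i - 1) (j - 1)) \<and>
     (\<forall>B\<in>carrier_mat n n.
        ((\<forall>j. 1 \<le> j \<and> j < n \<longrightarrow> ent B 1 j = 0) \<and>
         (\<forall>i\<in>{1..n}. ent B i n = m ^ (i - 1)) \<and>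
         (\<forall>i\<in>{2..n}. \<forall>j\<in>{1..n - 1}.
            ent B i j = m * ent B (i - 1) j + ent B (i - 1) (j + 1)))
        \<longleftrightarrow> B = T n m)"
  unfolding ent_conditions_iff
  using T_pow_mult_w T_pow_relation T_characterization[OF assms] by blast

end
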